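(* Let $n\ge 1$, $p>1$, and let $\mathcal A:\mathbb R^n_+\times[0,\infty)\times\mathbb R^n\to\mathbb R^n$ be a Carathéodory function that is weakly $p$-coercive with constant $k>0$, i.e. $$\mathcal A(x,t,\xi)\cdot\xi\ \ge\ k\,|\mathcal A(x,t,\xi)|^{p'}\qquad\text{for all }(x,t,\xi)\in\mathbb R^n_+\times[0,\infty)\times\mathbb R^n,\quad p'=\tfrac{p}{p-1}.$$ Let $f:[0,\infty)\to[0,\infty)$ be continuous and nondecreasing with $\lim_{t\to+\infty}f(t)=+\infty$. Let $u\in C^1(\mathbb R^n_+)\cap C(\overline{\mathbb R^n_+})$ be nonnegative and satisfy $$\int_{\mathbb R^n_+}\mathcal A(x,u,\nabla u)\cdot\nabla\psi\,dx\ \ge\ \int_{\mathbb R^n_+}f(u)\,\psi\,dx\qquad\text{for all }\psi\in C_0^\infty(\mathbb R^n_+),\ \psi\ge 0,$$ with $c_1:=\|\nabla u\|_{L^\infty(\mathbb R^n_+)}<\infty$ and $c_2:=\sup_{\partial\mathbb R^n_+}u<\infty$. Put $c_0:=2^n-1$. Then for every $R>0$, $$\sup_{\mathbb R^n_+}u\ \le\ \max\left(c_2+c_1R,\ \ f^{-1}\!\Big(\frac{c_0\,k^{1-p}c_1^{p-1}}{R}\Big)+2c_1R\right).$$ If moreover $f$ is strictly increasing with $f(0)=0$ and $c_1>0$, then the equation $$R\,f(c_1R)=c_0\,k^{1-p}c_1^{p-1}$$ has a unique root $R_*\in(0,\infty)$, and $$\sup_{\mathbb R^n_+}u\ \le\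 \max\left(c_2+c_1R_*,\ 3c_1R_*\right).$$
   Context: $\mathbb R^n_+=\{x=(x',x_n)\in\mathbb R^n: x_n>0\}$ is the open half-space, with boundary $\partial\mathbb R^n_+=\{x_n=0\}$. A Carathéodory function $\mathcal A(x,t,\xi)$ is measurable in $x$ for each $(t,\xi)$ and continuous in $(t,\xi)$ for a.e. $x$. $\mathcal A(x,u,\nabla u)$ means $\mathcal A(x,u(x),\nabla u(x))$. The generalized (right-continuous) inverse of $f$ is $f^{-1}(s):=\sup\{t\ge 0: f(t)\le s\}$ for $s\ge 0$. *)

theory Defs
  imports "HOL-Probability.Essential_Supremum"
begin

text \<open>The distinguished (``last'') coordinate is an arbitrary index \<open>m\<close>, so that dimension one
  is included.\<close>

definition half_space :: "'n::finite \<Rightarrow> (real^'n) set" where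
  "half_space m = {x. x $ m > 0}"

definition partial :: "'n::finite \<Rightarrow> (real^'n \<Rightarrow> real) \<Rightarrow> real^'n \<Rightarrow> real" where
  "partial i g x = frechet_derivative g (at x) (axis i 1)"

definition grad :: "(real^'n::finite \<Rightarrow> real) \<Rightarrow> real^'n \<Rightarrow> real^'n" where
  "grad g x = (\<chi> i. partial i g x)"

text \<open>Intended for open \<open>\<Omega>\<close> only: derivatives are taken with respect to the full neighbourhood.\<close>

primrec Ck_on :: "nat \<Rightarrow> (real^'n::finite) set \<Rightarrow> (real^'n \<Rightarrow> real) \<Rightarrow> bool" where
  "Ck_on 0 \<Omega> g \<longleftrightarrow> continuous_on \<Omega> g"
| "Ck_on (Suc k) \<Omega> g \<longleftrightarrow> (\<forall>x\<in>\<Omega>. g differentiable at x) \<and> (\<forall>i. Ck_on k \<Omega> (partial i g))"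

text \<open>\<open>C\<^sub>0\<^sup>\<infinity>(\<Omega>)\<close>, its elements being identified with their extensions by zero.\<close>

definition test_functions :: "(real^'n::finite) set \<Rightarrow> (real^'n \<Rightarrow> real) set" where
  "test_functions \<Omega> =
     {\<psi>. (\<forall>k. Ck_on k UNIV \<psi>) \<and> compact (closure {x. \<psi> x \<noteq> 0}) \<and> closure {x. \<psi> x \<noteq> 0} \<subseteq> \<Omega>}"

definition caratheodory ::
  "(real^'n::finite) set \<Rightarrow> (real^'n \<Rightarrow> real \<Rightarrow> real^'n \<Rightarrow> real^'n) \<Rightarrow> bool" where
  "caratheodory \<Omega> A \<longleftrightarrow>
     (\<forall>t\<ge>0. \<forall>\<xi>. (\<lambda>x. A x t \<xi>) \<in> borel_measurable (lebesgue_on \<Omega>)) \<and>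
     (AE x in lebesgue_on \<Omega>. continuous_on ({0..} \<times> UNIV) (\<lambda>(t, \<xi>). A x t \<xi>))"

definition weakly_coercive ::
  "real \<Rightarrow> real \<Rightarrow> (real^'n::finite) set \<Rightarrow> (real^'n \<Rightarrow> real \<Rightarrow> real^'n \<Rightarrow> real^'n) \<Rightarrow> bool" where
  "weakly_coercive p k \<Omega> A \<longleftrightarrow>
     (\<forall>x\<in>\<Omega>. \<forall>t\<ge>0. \<forall>\<xi>. A x t \<xi> \<bullet> \<xi> \<ge> k * norm (A x t \<xi>) powr (p / (p - 1)))"

text \<open>The supremum is taken in the extended reals; it is \<open>-\<infinity>\<close> if \<open>s < f t\<close> for all \<open>t \<ge> 0\<close>.\<close>

definition gen_inverse :: "(real \<Rightarrow> real) \<Rightarrow> real \<Rightarrow> ereal" where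
  "gen_inverse f s = (SUP t\<in>{t. t \<ge> 0 \<and> f t \<le> s}. ereal t)"

end

theory Submission
  imports Defs "HOL-Computational_Algebra.Polynomial"
begin

text \<open>
  Coercivity gives \<open>|\<A>| \<le> B := k\<^bsup>1-p\<^esup> c\<^sub>1\<^bsup>p-1\<^esup>\<close> along \<open>u\<close>, so testing with a cutoff \<open>\<psi>\<close>
  yields \<open>min\<^bsub>supp \<psi>\<^esub> f(u) \<cdot> \<integral>\<psi> \<le> B \<integral>|\<nabla>\<psi>|\<close>. Take for \<open>\<psi>\<close> a smooth approximation of the indicator
  of a cube of half side \<open>a\<close>, namely a product of one-dimensional bumps \<open>exp(-\<epsilon>/(1-t\<^sup>2))\<close>; up to
  a factor \<open>3/2\<close> the quotient \<open>\<integral>|\<nabla>\<psi>| / \<integral>\<psi>\<close> is then at most \<open>n/a\<close>. If \<open>x\<^sub>n > R\<close>, the cube with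
  centre \<open>x + (R/2) e\<^sub>n\<close> and \<open>a = 3R/(2\<surd>n)\<close> lies in the half-space and within distance \<open>2R\<close> of \<open>x\<close>,
  and \<open>n\<surd>n \<le> 2\<^sup>n - 1\<close> bounds \<open>f(u)\<close> at the minimum point of \<open>u\<close> on the cube by \<open>c\<^sub>0B/R\<close>; as \<open>u\<close> is
  \<open>c\<^sub>1\<close>-Lipschitz, this bounds \<open>u(x)\<close>. If \<open>x\<^sub>n \<le> R\<close>, the Lipschitz bound is used between \<open>x\<close> and
  its projection to the boundary.
\<close>

section \<open>A smooth bump on the line\<close>

text \<open>The family contains the bump \<open>exp (- e / (1 - t\<^sup>2))\<close> itself, as
  \<open>P = 1\<close>, \<open>k = 0\<close>, and is closed under differentiation, so that one
  derivative rule covers all orders.\<close>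

definition bump_quot :: "real \<Rightarrow> real poly \<Rightarrow> nat \<Rightarrow> real \<Rightarrow> real" where
  "bump_quot e P k t =
     (if \<bar>t\<bar> < 1 then poly P t / (1 - t\<^sup>2) ^ k * exp (- e / (1 - t\<^sup>2)) else 0)"

text \<open>The numerator arising when \<open>P(t) (1-t\<^sup>2)\<^bsup>-k\<^esup> exp(-e/(1-t\<^sup>2))\<close> is differentiated and the result is
  written over \<open>(1-t\<^sup>2)\<^bsup>k+2\<^esup>\<close>.\<close>

definition bump_num :: "real \<Rightarrow> nat \<Rightarrow> real poly \<Rightarrow> real poly" where
  "bump_num e k P = pderiv P * [:1, 0, -1:]\<^sup>2 + smult (2 * real k) ([:0, 1:] * P * [:1, 0, -1:])
     - smult (2 * e) ([:0, 1:] * P)"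

text \<open>One term of the exponential series is at most its sum. For \<open>y = e / q\<close> this
  bounds \<open>exp (- e / q)\<close> by powers of \<open>q\<close>.\<close>

lemma power_le_fact_mult_exp:
  fixes y :: real
  assumes "y \<ge> 0"
  shows "y ^ N \<le> fact N * exp y"
proof -
  have s: "(\<lambda>n. y ^ n /\<^sub>R fact n) sums exp y" by (rule exp_converges)
  have "(\<Sum>n\<in>{N}. y ^ n /\<^sub>R fact n) \<le> exp y"
    using sum_le_suminf[OF sums_summable[OF s], of "{N}"] assms sums_unique[OF s] by simp
  then show ?thesis by (simp add: field_simps)
qed

text \<open>Vanishing to second order at \<open>t = 1\<close> and \<open>t = -1\<close> is what
  makes the extension by zero differentiable there. The exponential outweighs the pole, and
  \<open>P\<close> is bounded on \<open>{-1..1}\<close>.\<close>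

lemma bump_quot_le_square:
  assumes "e > 0"
  obtains K where "\<And>t. \<bar>bump_quot e P k t\<bar> \<le> K * (1 - t\<^sup>2)\<^sup>2"
proof -
  have "compact (poly P ` {-1..1})"
    by (intro compact_continuous_image continuous_intros) simp
  then obtain B where B: "\<And>t. t \<in> {-1..1} \<Longrightarrow> \<bar>poly P t\<bar> \<le> B"
    using compact_imp_bounded bounded_iff by (metis imageI real_norm_def)
  have B0: "B \<ge> 0" by (rule order_trans[OF abs_ge_zero B[of 0]]) simp
  have "\<bar>bump_quot e P k t\<bar> \<le> (B * fact (k + 2) / e ^ (k + 2)) * (1 - t\<^sup>2)\<^sup>2" for t
  proof (cases "\<bar>t\<bar> < 1")
    case True
    define q where "q = 1 - t\<^sup>2"
    have q: "q > 0" using True by (simp add: q_def abs_square_less_1)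
    \<comment> \<open>With the exponent \<open>k + 2\<close>, \<open>k\<close> powers of
      \<open>q\<close> cancel the denominator \<open>q ^ k\<close> and a square remains.\<close>
    have "exp (- e / q) \<le> fact (k + 2) * q ^ (k + 2) / e ^ (k + 2)"
      using power_le_fact_mult_exp[of "e / q" "k + 2"] q assms
      by (simp add: exp_minus field_simps power_divide)
    then have "\<bar>bump_quot e P k t\<bar> \<le> B / q ^ k * (fact (k + 2) * q ^ (k + 2) / e ^ (k + 2))"
      using B[of t, simplified] abs_less_iff True q B0
      unfolding bump_quot_def q_def[symmetric] if_P[OF True] abs_mult abs_divide
      by (intro mult_mono divide_mono) (auto simp: abs_less_iff)
    also have "\<dots> = (B * fact (k + 2) / e ^ (k + 2)) * q\<^sup>2"
      using q by (simp add: power_add field_simps power2_eq_square del: fact_Suc)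
    finally show ?thesis by (simp add: q_def)
  next
    case False
    then show ?thesis using B0 assms by (simp add: bump_quot_def)
  qed
  then show ?thesis using that by blast
qed

text \<open>Inside the interval this is the quotient rule, outside the function is locally zero, and
  at the endpoints \<open>bump_quot_le_square\<close> forces the difference quotient to 0.\<close>

lemma bump_quot_has_derivative:
  assumes "e > 0"
  shows "(bump_quot e P k has_real_derivative bump_quot e (bump_num e k P) (k + 2) t) (at t)"
proof -
  consider "\<bar>t\<bar> < 1" | "\<bar>t\<bar> > 1" | "\<bar>t\<bar> = 1" by linarith
  then show ?thesis
  proof cases
    case 1
    define q where "q = 1 - t\<^sup>2"
    have q: "q > 0" using 1 by (simp add: q_def abs_square_less_1)
    have d1: "((\<lambda>s. 1 - s\<^sup>2) has_real_derivative - 2 * t) (at t)"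
      by (auto intro!: derivative_eq_intros)
    have d2: "((\<lambda>s. (1 - s\<^sup>2) ^ k) has_real_derivative real k * q ^ (k - 1) * (- 2 * t)) (at t)"
      by (rule DERIV_cong[OF DERIV_power[OF d1]]) (simp add: q_def)
    have d3: "((\<lambda>s. exp (- e / (1 - s\<^sup>2))) has_real_derivative
        exp (- e / q) * (- 2 * e * t / q\<^sup>2)) (at t)"
      using q unfolding q_def by (auto intro!: derivative_eq_intros simp: power2_eq_square)
    have "((\<lambda>t. poly P t / (1 - t\<^sup>2) ^ k * exp (- e / (1 - t\<^sup>2))) has_real_derivative
        ((poly (pderiv P) t * q ^ k - poly P t * (real k * q ^ (k - 1) * (- 2 * t))) / (q ^ k * q ^ k))
         * exp (- e / q) + exp (- e / q) * (- 2 * e * t / q\<^sup>2) * (poly P t / q ^ k)) (at t)"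
      using DERIV_mult[OF DERIV_divide[OF poly_DERIV d2] d3, of P] q by (simp add: q_def)
    moreover have "((poly (pderiv P) t * q ^ k - poly P t * (real k * q ^ (k - 1) * (- 2 * t))) / (q ^ k * q ^ k))
         * exp (- e / q) + exp (- e / q) * (- 2 * e * t / q\<^sup>2) * (poly P t / q ^ k)
        = bump_quot e (bump_num e k P) (k + 2) t"
    proof -
      \<comment> \<open>For \<open>k = 0\<close> the truncated exponent \<open>k - 1\<close> does no
        harm, because of the factor \<open>real k\<close>.\<close>
      have 1: "poly P t * (real k * q ^ (k - 1) * (- 2 * t)) = - 2 * real k * t * poly P t * q ^ k / q"
        using q by (cases k) (auto simp: field_simps)
      have 2: "poly (bump_num e k P) t = poly (pderiv P) t * q\<^sup>2 + 2 * real k * t * poly P t * q - 2 * e * t * poly P t"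
        by (simp add: bump_num_def q_def power2_eq_square algebra_simps)
      have 3: "bump_quot e (bump_num e k P) (k + 2) t = poly (bump_num e k P) t / (q ^ k * q\<^sup>2) * exp (- e / q)"
        using 1 \<open>\<bar>t\<bar> < 1\<close> by (simp add: bump_quot_def q_def power_add power2_eq_square)
      show ?thesis unfolding 1 2 3 using q by (simp add: field_simps power2_eq_square)
    qed
    ultimately have "((\<lambda>t. poly P t / (1 - t\<^sup>2) ^ k * exp (- e / (1 - t\<^sup>2))) has_real_derivative
        bump_quot e (bump_num e k P) (k + 2) t) (at t)"
      by simp
    then show ?thesis
      by (rule has_field_derivative_transform_within_open[where S = "{-1<..<1}"])
         (use 1 in \<open>auto simp: bump_quot_def\<close>)
  next
    case 2
    have "((\<lambda>_. 0) has_real_derivative 0) (at t)" by simp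
    then have "(bump_quot e P k has_real_derivative 0) (at t)"
      by (rule has_field_derivative_transform_within_open[where S = "- {-1..1}"])
         (use 2 in \<open>auto simp: bump_quot_def\<close>)
    then show ?thesis using 2 by (simp add: bump_quot_def)
  next
    case 3
    obtain K where K: "\<And>s. \<bar>bump_quot e P k s\<bar> \<le> K * (1 - s\<^sup>2)\<^sup>2"
      using bump_quot_le_square[OF assms, of P k] by metis
    have t: "t\<^sup>2 = 1" using 3 by (metis power2_abs one_power2)
    \<comment> \<open>As \<open>t\<^sup>2 = 1\<close>, \<open>1 - s\<^sup>2\<close> has the factor
      \<open>s - t\<close>; its square keeps one such factor after the division.\<close>
    have b: "\<bar>(bump_quot e P k s - 0) / (s - t)\<bar> \<le> K * \<bar>s - t\<bar> * (s + t)\<^sup>2" if "s \<noteq> t" for s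
    proof -
      have "1 - s\<^sup>2 = - ((s - t) * (s + t))" using t by (simp add: power2_eq_square algebra_simps)
      then have "(1 - s\<^sup>2)\<^sup>2 = \<bar>s - t\<bar> * (\<bar>s - t\<bar> * (s + t)\<^sup>2)"
        by (simp add: power_mult_distrib power2_eq_square)
      then show ?thesis using K[of s] that by (simp add: divide_simps algebra_simps)
    qed
    have "((\<lambda>s. K * \<bar>s - t\<bar> * (s + t)\<^sup>2) \<longlongrightarrow> 0) (at t)"
      by (auto intro!: tendsto_eq_intros)
    then have "((\<lambda>s. (bump_quot e P k s - 0) / (s - t)) \<longlongrightarrow> 0) (at t)"
      by (rule Lim_null_comparison[rotated])
         (auto simp: eventually_at_filter b[simplified] intro!: always_eventually)
    then show ?thesis using 3 by (simp add: has_field_derivative_iff bump_quot_def)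
  qed
qed

fun bump_pair :: "real \<Rightarrow> nat \<Rightarrow> real poly \<times> nat" where
  "bump_pair e 0 = (1, 0)"
| "bump_pair e (Suc j) = (let (P, k) = bump_pair e j in (bump_num e k P, k + 2))"

definition bump_deriv :: "real \<Rightarrow> nat \<Rightarrow> real \<Rightarrow> real" where
  "bump_deriv e j = (case bump_pair e j of (P, k) \<Rightarrow> bump_quot e P k)"

lemma bump_deriv_has_derivative:
  "e > 0 \<Longrightarrow> (bump_deriv e j has_real_derivative bump_deriv e (Suc j) t) (at t)"
  using bump_quot_has_derivative[of e] by (auto simp: bump_deriv_def split: prod.splits)

lemma bump_deriv_eq_0: "t \<notin> {-1<..<1} \<Longrightarrow> bump_deriv e j t = 0"
  by (auto simp: bump_deriv_def bump_quot_def abs_less_iff split: prod.splits)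

lemma bump_deriv_0: "bump_deriv e 0 t = (if \<bar>t\<bar> < 1 then exp (- e / (1 - t\<^sup>2)) else 0)"
  by (simp add: bump_deriv_def bump_quot_def)

lemma bump_deriv_nonneg: "bump_deriv e 0 t \<ge> 0"
  by (simp add: bump_deriv_0)

lemma bump_deriv_1:
  "bump_deriv e 1 t = (if \<bar>t\<bar> < 1 then - 2 * e * t / (1 - t\<^sup>2)\<^sup>2 * exp (- e / (1 - t\<^sup>2)) else 0)"
  by (simp add: bump_deriv_def bump_quot_def bump_num_def numeral_2_eq_2)

lemma isCont_bump_deriv: "e > 0 \<Longrightarrow> isCont (bump_deriv e j) t"
  using bump_deriv_has_derivative DERIV_isCont by blast

lemma borel_measurable_bump_deriv: "e > 0 \<Longrightarrow> bump_deriv e j \<in> borel_measurable borel"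
  by (simp add: borel_measurable_continuous_onI continuous_at_imp_continuous_on isCont_bump_deriv)

lemma integrable_bump_deriv:
  assumes "e > 0"
  shows "integrable lborel (bump_deriv e j)"
proof -
  have "integrable lborel (\<lambda>t. indicator {-1..1} t *\<^sub>R bump_deriv e j t)"
    by (intro borel_integrable_compact continuous_at_imp_continuous_on ballI isCont_bump_deriv assms) auto
  also have "(\<lambda>t. indicator {-1..1} t *\<^sub>R bump_deriv e j t) = bump_deriv e j"
  proof
    fix t
    show "indicator {-1..1} t *\<^sub>R bump_deriv e j t = bump_deriv e j t"
      using bump_deriv_eq_0[of t e j] by (cases "t \<in> {-1<..<1}") auto
  qed
  finally show ?thesis .
qed

section \<open>One-dimensional integrals of the bump and of its derivative\<close>

lemma bump_deriv_1_sign: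
  assumes "e > 0"
  shows "t \<le> 0 \<Longrightarrow> bump_deriv e 1 t \<ge> 0" "t \<ge> 0 \<Longrightarrow> bump_deriv e 1 t \<le> 0"
  using assms unfolding bump_deriv_1
  by (auto simp: mult_le_0_iff zero_le_mult_iff divide_le_0_iff zero_le_divide_iff)

text \<open>This is the total variation: the bump rises from 0 to \<open>exp (- e)\<close> at the
  origin and falls back to 0.\<close>

lemma integral_abs_bump_deriv_1:
  assumes "e > 0"
  shows "(\<integral>t. \<bar>bump_deriv e 1 t\<bar> \<partial>lborel) = 2 * exp (- e)"
proof -
  have D: "(bump_deriv e 0 has_real_derivative bump_deriv e 1 t) (at t)" for t
    using bump_deriv_has_derivative[OF assms, of 0] by simp
  note [measurable] = borel_measurable_bump_deriv[OF assms]
  \<comment> \<open>The fundamental theorem is used in its form for nonnegative integrands, hence on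
    each side of 0 separately.\<close>
  have "has_bochner_integral lborel (\<lambda>t. bump_deriv e 1 t * indicator {-1..0} t)
          (bump_deriv e 0 0 - bump_deriv e 0 (-1))"
    by (rule has_bochner_integral_FTC_Icc_nonneg)
       (use D bump_deriv_1_sign[OF assms] in \<open>auto intro: has_field_derivative_at_within simp del: One_nat_def\<close>)
  moreover have "has_bochner_integral lborel (\<lambda>t. - bump_deriv e 1 t * indicator {0..1} t)
          (- bump_deriv e 0 1 - - bump_deriv e 0 0)"
    by (rule has_bochner_integral_FTC_Icc_nonneg[where F = "\<lambda>t. - bump_deriv e 0 t"])
       (use D bump_deriv_1_sign[OF assms] in
         \<open>auto intro: has_field_derivative_at_within DERIV_minus simp del: One_nat_def\<close>)
  ultimately have "has_bochner_integral lborel (\<lambda>t. bump_deriv e 1 t * indicator {-1..0} t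
        + - bump_deriv e 1 t * indicator {0..1} t) (2 * exp (- e))"
    using has_bochner_integral_add by (fastforce simp: bump_deriv_0)
  \<comment> \<open>At \<open>t = 0\<close> both indicators are 1, but the derivative vanishes
    there.\<close>
  moreover have "bump_deriv e 1 t * indicator {-1..0} t + - bump_deriv e 1 t * indicator {0..1} t
       = \<bar>bump_deriv e 1 t\<bar>" for t
    using bump_deriv_1_sign[OF assms, of t] bump_deriv_eq_0[of t e 1]
    by (auto simp: indicator_def simp del: One_nat_def)
  ultimately show ?thesis by (simp add: has_bochner_integral_integral_eq)
qed

lemma integral_bump_ge:
  assumes "e > 0" "0 < b" "b < 1"
  shows "(\<integral>t. bump_deriv e 0 t \<partial>lborel) \<ge> 2 * b * exp (- e / (1 - b\<^sup>2))"
proof -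
  have "2 * b * exp (- e / (1 - b\<^sup>2)) = (\<integral>t. exp (- e / (1 - b\<^sup>2)) * indicator {-b..b} t \<partial>lborel)"
    using assms by simp
  also have "\<dots> \<le> (\<integral>t. bump_deriv e 0 t \<partial>lborel)"
  proof (rule integral_mono')
    fix t :: real
    show "exp (- e / (1 - b\<^sup>2)) * indicator {-b..b} t \<le> bump_deriv e 0 t"
    proof (cases "t \<in> {-b..b}")
      case True
      then have "t\<^sup>2 \<le> b\<^sup>2" using assms by (auto simp: abs_le_square_iff[symmetric])
      moreover have "b\<^sup>2 < 1" using assms by (simp add: abs_square_less_1)
      ultimately have "e / (1 - t\<^sup>2) \<le> e / (1 - b\<^sup>2)"
        using assms by (intro divide_left_mono mult_pos_pos) auto
      then show ?thesis using True assms by (auto simp: bump_deriv_0)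
    qed (simp add: bump_deriv_0)
  qed (rule integrable_bump_deriv[OF assms(1)], simp add: bump_deriv_0)
  finally show ?thesis .
qed

text \<open>For small \<open>e\<close> the bump is nearly the indicator of the interval, for which
  variation and integral are both 2; \<open>e = 1 / 20\<close> is small enough for the ratio
  \<open>3 / 2\<close>.\<close>

lemma integral_abs_bump_deriv_1_le:
  defines "e \<equiv> 1 / 20 :: real"
  shows "(\<integral>t. \<bar>bump_deriv e 1 t\<bar> \<partial>lborel) \<le> 3 / 2 * (\<integral>t. bump_deriv e 0 t \<partial>lborel)"
proof -
  \<comment> \<open>For \<open>b = 4 / 5\<close> the exponents differ by \<open>- 4 / 45\<close>, so
    \<open>exp y \<ge> 1 + y\<close> yields the factor \<open>5 / 6\<close>. Then
    \<open>2 * b * (5 / 6) = 4 / 3\<close>, and \<open>3 / 2 * (4 / 3) = 2\<close> matches the total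
    variation \<open>2 * exp (- e)\<close>.\<close>
  have "exp (- e) * (5/6) \<le> exp (- e) * exp (e - e / (1 - (4/5)\<^sup>2))"
    using exp_ge_add_one_self[of "e - e / (1 - (4/5)\<^sup>2)"]
    by (intro mult_left_mono) (auto simp: e_def power2_eq_square)
  also have "\<dots> = exp (- e / (1 - (4/5)\<^sup>2))" by (simp flip: exp_add)
  finally show ?thesis
    using integral_bump_ge[of e "4/5"] integral_abs_bump_deriv_1[of e]
    by (simp add: e_def)
qed

section \<open>Smooth bumps on cubes\<close>

text \<open>\<open>s\<close> is a multi-index: \<open>cube_bump e a c s\<close> is the partial derivative of order \<open>s\<close> of the bump
  on the cube with centre \<open>c\<close> and half side \<open>a\<close>.\<close>

definition cube_bump :: "real \<Rightarrow> real \<Rightarrow> real^'n::finite \<Rightarrow> ('n \<Rightarrow> nat) \<Rightarrow> real^'n \<Rightarrow> real" where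
  "cube_bump e a c s x = (\<Prod>i\<in>UNIV. bump_deriv e (s i) ((x $ i - c $ i) / a) / a ^ s i)"

lemma cube_bump_has_derivative:
  fixes c :: "real^'n::finite"
  assumes "e > 0" "a > 0"
  shows "(cube_bump e a c s has_derivative
     (\<lambda>h. \<Sum>i\<in>UNIV. h $ i * cube_bump e a c (s(i := Suc (s i))) x)) (at x)"
proof -
  have d: "((\<lambda>x. bump_deriv e (s i) ((x $ i - c $ i) / a) / a ^ s i) has_derivative
      (\<lambda>h. h $ i * (bump_deriv e (Suc (s i)) ((x $ i - c $ i) / a) / a ^ Suc (s i)))) (at x)" for i
  proof -
    have "((\<lambda>r. bump_deriv e (s i) ((r - c $ i) / a) / a ^ s i) has_real_derivative
        bump_deriv e (Suc (s i)) ((x $ i - c $ i) / a) / a ^ Suc (s i)) (at (x $ i))"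
    proof -
      have "((\<lambda>r. (r - c $ i) / a) has_real_derivative 1 / a) (at (x $ i))"
        using assms by (auto intro!: derivative_eq_intros)
      from DERIV_cdivide[OF DERIV_chain2[OF bump_deriv_has_derivative[OF assms(1)] this], of "s i" "a ^ s i"]
      show ?thesis by (simp add: field_simps)
    qed
    then have "((\<lambda>r. bump_deriv e (s i) ((r - c $ i) / a) / a ^ s i) has_derivative
        (\<lambda>r. r * (bump_deriv e (Suc (s i)) ((x $ i - c $ i) / a) / a ^ Suc (s i)))) (at (x $ i))"
      unfolding has_field_derivative_def by (rule has_derivative_eq_rhs) (simp add: fun_eq_iff)
    from has_derivative_compose[OF bounded_linear_imp_has_derivative[OF bounded_linear_vec_nth] this]
    show ?thesis .
  qed
  show ?thesis
    unfolding cube_bump_def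
  proof (rule has_derivative_eq_rhs[OF has_derivative_prod[OF d]], rule ext, rule sum.cong[OF refl])
    fix h :: "real^'n" and i :: 'n
    show "h $ i * (bump_deriv e (Suc (s i)) ((x $ i - c $ i) / a) / a ^ Suc (s i)) *
         (\<Prod>j\<in>UNIV - {i}. bump_deriv e (s j) ((x $ j - c $ j) / a) / a ^ s j) =
       h $ i * (\<Prod>j\<in>UNIV. bump_deriv e ((s(i := Suc (s i))) j) ((x $ j - c $ j) / a) / a ^ (s(i := Suc (s i))) j)"
      by (subst prod.remove[of UNIV i]) (auto intro!: prod.cong)
  qed
qed

lemma partial_cube_bump:
  assumes "e > 0" "a > 0"
  shows "partial i (cube_bump e a c s) = cube_bump e a c (s(i := Suc (s i)))"
  by (rule ext)
     (simp add: partial_def frechet_derivative_at[OF cube_bump_has_derivative[OF assms], symmetric] axis_def if_distrib[of "\<lambda>r. r * _"]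
       cong: if_cong)

text \<open>Partial derivatives stay in the family with one order raised, so the induction ranges
  over all multi-indices \<open>s\<close>.\<close>

lemma Ck_on_cube_bump: "e > 0 \<Longrightarrow> a > 0 \<Longrightarrow> Ck_on k UNIV (cube_bump e a c s)"
proof (induction k arbitrary: s)
  case 0
  then show ?case
    by (auto intro!: continuous_at_imp_continuous_on has_derivative_continuous[OF cube_bump_has_derivative])
next
  case (Suc k)
  then show ?case
    by (auto simp: partial_cube_bump intro: differentiableI cube_bump_has_derivative)
qed

lemma cube_bump_eq_0:
  fixes x c :: "real^'n::finite"
  assumes "a > 0" "x \<notin> cbox (c - (\<chi> i. a)) (c + (\<chi> i. a))"
  shows "cube_bump e a c s x = 0"
proof -
  obtain i where "\<not> (c $ i - a \<le> x $ i \<and> x $ i \<le> c $ i + a)"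
    using assms(2) by (auto simp: mem_box_cart)
  then have "bump_deriv e (s i) ((x $ i - c $ i) / a) = 0"
    using assms(1) by (intro bump_deriv_eq_0) (auto simp: field_simps)
  then show ?thesis by (auto simp: cube_bump_def intro!: prod_zero)
qed

lemma cube_bump_test_function:
  assumes "e > 0" "a > 0" "cbox (c - (\<chi> i. a)) (c + (\<chi> i. a)) \<subseteq> \<Omega>"
  shows "cube_bump e a c s \<in> test_functions \<Omega>"
proof -
  have "closure {x. cube_bump e a c s x \<noteq> 0} \<subseteq> cbox (c - (\<chi> i. a)) (c + (\<chi> i. a))"
    using cube_bump_eq_0[OF assms(2)] by (intro closure_minimal closed_cbox) blast
  moreover from this have "compact (closure {x. cube_bump e a c s x \<noteq> 0})"
    by (meson bounded_cbox bounded_subset closed_closure compact_eq_bounded_closed)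
  ultimately show ?thesis
    using assms by (auto simp: test_functions_def Ck_on_cube_bump)
qed

lemma cube_bump_nonneg: "cube_bump e a c (\<lambda>_. 0) x \<ge> 0"
  by (simp add: cube_bump_def bump_deriv_0 prod_nonneg)

section \<open>Integrals of the bumps on cubes\<close>

lemma has_bochner_integral_lborel_prod_cart:
  fixes g :: "'n::finite \<Rightarrow> real \<Rightarrow> real"
  assumes "\<And>i. integrable lborel (g i)" and "\<And>i t. g i t \<ge> 0"
  shows "has_bochner_integral lborel (\<lambda>x::real^'n. \<Prod>i\<in>UNIV. g i (x $ i)) (\<Prod>i\<in>UNIV. integral\<^sup>L lborel (g i))"
proof (rule has_bochner_integral_nn_integral)
  \<comment> \<open>The product formula for \<open>lborel\<close> runs over \<open>Basis\<close>;
    \<open>axis_index\<close> turns a basis vector back into its coordinate.\<close>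
  define G where "G b = g (axis_index b)" for b :: "real^'n"
  have [measurable]: "g i \<in> borel_measurable borel" for i
    using borel_measurable_integrable[OF assms(1)] by simp
  have eq: "(\<Prod>b\<in>Basis. h b) = (\<Prod>i\<in>UNIV. h (axis i 1))" for h :: "real^'n \<Rightarrow> ennreal"
  proof -
    have "Basis = (\<lambda>i. axis i (1::real)) ` (UNIV :: 'n set)" by (auto simp: Basis_vec_def)
    moreover have "inj (\<lambda>i::'n. axis i (1::real))" by (auto simp: inj_def axis_eq_axis)
    ultimately show ?thesis by (metis (no_types, lifting) prod.reindex_cong)
  qed
  show "(\<lambda>x::real^'n. \<Prod>i\<in>UNIV. g i (x $ i)) \<in> borel_measurable lborel"
    by simp
  have "(\<integral>\<^sup>+x. ennreal (\<Prod>i\<in>UNIV. g i ((x::real^'n) $ i)) \<partial>lborel)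
      = (\<integral>\<^sup>+x. (\<Prod>b\<in>Basis. ennreal (G b (x \<bullet> b))) \<partial>lborel)"
    by (simp add: eq G_def axis_index_axis inner_axis prod_ennreal assms(2))
  also have "\<dots> = (\<Prod>b\<in>Basis. \<integral>\<^sup>+t. ennreal (G b t) \<partial>lborel)"
    by (rule nn_integral_lborel_prod) (auto simp: G_def)
  also have "\<dots> = (\<Prod>i\<in>UNIV. ennreal (integral\<^sup>L lborel (g i)))"
    by (simp add: eq G_def axis_index_axis nn_integral_eq_integral assms)
  also have "\<dots> = ennreal (\<Prod>i\<in>UNIV. integral\<^sup>L lborel (g i))"
    by (simp add: prod_ennreal integral_nonneg assms(2))
  finally show "(\<integral>\<^sup>+x. ennreal (\<Prod>i\<in>UNIV. g i ((x::real^'n) $ i)) \<partial>lborel) = ennreal (\<Prod>i\<in>UNIV. integral\<^sup>L lborel (g i))" .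
qed (auto simp: prod_nonneg integral_nonneg assms(2))

lemma has_bochner_integral_abs_cube_bump:
  fixes c :: "real^'n::finite"
  assumes "e > 0" "a > 0"
  shows "has_bochner_integral lborel (\<lambda>x. \<bar>cube_bump e a c s x\<bar>)
      (\<Prod>i\<in>UNIV. a * (\<integral>t. \<bar>bump_deriv e (s i) t\<bar> \<partial>lborel) / a ^ s i)"
proof -
  define g where "g i t = \<bar>bump_deriv e (s i) ((t - c $ i) / a)\<bar> / a ^ s i" for i t
  have "has_bochner_integral lborel (g i) (a * (\<integral>t. \<bar>bump_deriv e (s i) t\<bar> \<partial>lborel) / a ^ s i)" for i
  proof -
    have "has_bochner_integral lborel (\<lambda>t. \<bar>bump_deriv e (s i) t\<bar>) (\<integral>t. \<bar>bump_deriv e (s i) t\<bar> \<partial>lborel)"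
      by (intro has_bochner_integral_integrable integrable_abs integrable_bump_deriv assms)
    then have "has_bochner_integral lborel (\<lambda>t. \<bar>bump_deriv e (s i) (- (c $ i) / a + (1 / a) * t)\<bar>)
        ((\<integral>t. \<bar>bump_deriv e (s i) t\<bar> \<partial>lborel) /\<^sub>R \<bar>1 / a\<bar>)"
      using assms by (subst (asm) lborel_has_bochner_integral_real_affine_iff[of "1 / a" _ _ "- (c $ i) / a"]) auto
    then have "has_bochner_integral lborel (\<lambda>t. \<bar>bump_deriv e (s i) (- (c $ i) / a + (1 / a) * t)\<bar> / a ^ s i)
        (((\<integral>t. \<bar>bump_deriv e (s i) t\<bar> \<partial>lborel) /\<^sub>R \<bar>1 / a\<bar>) / a ^ s i)"
      by (rule has_bochner_integral_divide_zero)
    then show ?thesis using assms by (simp add: g_def[abs_def] diff_divide_distrib)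
  qed
  note g = this
  have "has_bochner_integral lborel (\<lambda>x::real^'n. \<Prod>i\<in>UNIV. g i (x $ i)) (\<Prod>i\<in>UNIV. integral\<^sup>L lborel (g i))"
    by (rule has_bochner_integral_lborel_prod_cart)
       (use g assms in \<open>auto simp: has_bochner_integral_iff\<close>, auto simp: g_def)
  then show ?thesis
    using has_bochner_integral_integral_eq[OF g] assms
    by (simp add: g_def cube_bump_def abs_prod)
qed

lemma integrable_cube_bump:
  assumes "e > 0" "a > 0"
  shows "integrable lborel (cube_bump e a c s)"
proof (rule Bochner_Integration.integrable_bound)
  show "integrable lborel (\<lambda>x. \<bar>cube_bump e a c s x\<bar>)"
    using has_bochner_integral_abs_cube_bump[OF assms] has_bochner_integral_iff by blast
  show "cube_bump e a c s \<in> borel_measurable lborel"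
    using Ck_on_cube_bump[OF assms, of 0 c s] by (simp add: borel_measurable_continuous_onI)
qed simp

lemma integral_cube_bump:
  fixes c :: "real^'n::finite"
  assumes "e > 0" "a > 0"
  shows "(\<integral>x. cube_bump e a c (\<lambda>_. 0) x \<partial>lborel) = (a * (\<integral>t. bump_deriv e 0 t \<partial>lborel)) ^ CARD('n)"
  using has_bochner_integral_integral_eq[OF has_bochner_integral_abs_cube_bump[OF assms, of c "\<lambda>_. 0"]]
  by (simp add: cube_bump_nonneg bump_deriv_nonneg)

text \<open>Only the factor of index \<open>j\<close> changes, from \<open>a * J\<close> to
  \<open>D\<close> in the notation of the proof: there the scalings by \<open>a\<close> and
  \<open>1 / a\<close> cancel.\<close>

lemma integral_partial_cube_bump:
  fixes c :: "real^'n::finite"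
  assumes "e > 0" "a > 0"
  shows "a * (\<integral>t. bump_deriv e 0 t \<partial>lborel) * (\<integral>x. \<bar>partial j (cube_bump e a c (\<lambda>_. 0)) x\<bar> \<partial>lborel)
     = (\<integral>t. \<bar>bump_deriv e 1 t\<bar> \<partial>lborel) * (\<integral>x. cube_bump e a c (\<lambda>_. 0) x \<partial>lborel)"
proof -
  define J where "J = (\<integral>t. bump_deriv e 0 t \<partial>lborel)"
  define D where "D = (\<integral>t. \<bar>bump_deriv e 1 t\<bar> \<partial>lborel)"
  have "(\<integral>x. \<bar>partial j (cube_bump e a c (\<lambda>_. 0)) x\<bar> \<partial>lborel)
      = (\<Prod>i\<in>UNIV. if i = j then D else a * J)"
    using has_bochner_integral_integral_eq[OF has_bochner_integral_abs_cube_bump[OF assms, of c "(\<lambda>_. 0)(j := Suc 0)"]] assms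
    unfolding partial_cube_bump[OF assms]
    by (auto simp: bump_deriv_nonneg J_def D_def intro!: prod.cong)
  also have "\<dots> = D * (\<Prod>i\<in>UNIV - {j}. a * J)"
    by (subst prod.remove[of _ j]) (auto intro!: prod.cong)
  finally show ?thesis
    unfolding integral_cube_bump[OF assms] J_def[symmetric] D_def[symmetric]
    by (simp add: card_Diff_singleton power_eq_if)
qed

section \<open>The weak inequality on a cube\<close>

text \<open>Here \<open>v\<close> stands for f(u) and \<open>V\<close> for the flux. Testing with
  the cube bump bounds \<open>\<mu> * I\<close> by \<open>B\<close> times the sum of the
  \<open>CARD('n)\<close> integrals of \<open>\<bar>partial j \<psi> x\<bar>\<close>, each at most
  \<open>3 / (2 * a) * I\<close>, where \<open>I\<close> is the integral of
  \<open>\<psi>\<close>.\<close>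

lemma weak_inequality_cube_bound:
  fixes V :: "real^'n::finite \<Rightarrow> real^'n" and v :: "real^'n \<Rightarrow> real"
  assumes a: "a > 0" and Q: "cbox (c - (\<chi> i. a)) (c + (\<chi> i. a)) \<subseteq> \<Omega>"
    and cont: "continuous_on \<Omega> v"
    and V: "\<And>x. x \<in> \<Omega> \<Longrightarrow> norm (V x) \<le> B" and B: "B \<ge> 0"
    and weak: "\<And>\<psi>. \<psi> \<in> test_functions \<Omega> \<Longrightarrow> (\<forall>x. \<psi> x \<ge> 0) \<Longrightarrow>
      (LINT x:\<Omega>|lebesgue. V x \<bullet> grad \<psi> x) \<ge> (LINT x:\<Omega>|lebesgue. v x * \<psi> x)"
    and lower: "\<And>x. x \<in> cbox (c - (\<chi> i. a)) (c + (\<chi> i. a)) \<Longrightarrow> \<mu> \<le> v x"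
  shows "a * \<mu> \<le> 3 / 2 * real CARD('n) * B"
proof -
  define e :: real where "e = 1 / 20"
  have e: "e > 0" by (simp add: e_def)
  define \<psi> where "\<psi> = cube_bump e a c (\<lambda>_. 0)"
  define J where "J = (\<integral>t. bump_deriv e 0 t \<partial>lborel)"
  define D where "D = (\<integral>t. \<bar>bump_deriv e 1 t\<bar> \<partial>lborel)"
  define I where "I = (\<integral>x. \<psi> x \<partial>lborel)"
  define Q where "Q = cbox (c - (\<chi> i. a)) (c + (\<chi> i. a))"
  have J: "J > 0"
    unfolding J_def by (rule less_le_trans[OF _ integral_bump_ge[OF e, of "1/2"]]) auto
  have I: "I > 0"
    using a J by (simp add: I_def \<psi>_def integral_cube_bump[OF e a] J_def)
  have \<psi>0: "\<psi> x = 0" if "x \<notin> Q" for x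
    using cube_bump_eq_0[OF a] that unfolding \<psi>_def Q_def by blast
  have \<psi>_nonneg: "\<psi> x \<ge> 0" for x by (simp add: \<psi>_def cube_bump_nonneg)
  have \<psi>_int: "integrable lborel \<psi>" unfolding \<psi>_def by (rule integrable_cube_bump[OF e a])
  have \<psi>_cont: "continuous_on UNIV \<psi>"
    using Ck_on_cube_bump[OF e a, of 0] by (simp add: \<psi>_def)
  have "\<psi> \<in> test_functions \<Omega>"
    unfolding \<psi>_def by (rule cube_bump_test_function[OF e a \<open>cbox _ _ \<subseteq> \<Omega>\<close>])
  then have main: "(LINT x:\<Omega>|lebesgue. v x * \<psi> x) \<le> (LINT x:\<Omega>|lebesgue. V x \<bullet> grad \<psi> x)"
    using weak \<psi>_nonneg by blast
  have QO: "Q \<subseteq> \<Omega>" using Q by (simp add: Q_def)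
  have "\<mu> * I \<le> (LINT x:\<Omega>|lebesgue. v x * \<psi> x)"
  proof -
    \<comment> \<open>As \<open>\<psi>\<close> vanishes off \<open>Q\<close>, the integrand lives on
      a compact set, where continuity of \<open>v\<close> gives integrability.\<close>
    have eq: "(\<lambda>x. indicator \<Omega> x *\<^sub>R (v x * \<psi> x)) = (\<lambda>x. indicator Q x *\<^sub>R (v x * \<psi> x))"
      using QO \<psi>0 by (fastforce simp: indicator_def)
    have int: "integrable lborel (\<lambda>x. indicator Q x *\<^sub>R (v x * \<psi> x))"
      using QO unfolding Q_def
      by (intro borel_integrable_compact continuous_intros compact_cbox
          continuous_on_subset[OF cont] continuous_on_subset[OF \<psi>_cont]) auto
    have "\<mu> * I = (\<integral>x. \<mu> * \<psi> x \<partial>lborel)" by (simp add: I_def)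
    also have "\<dots> \<le> (\<integral>x. indicator Q x *\<^sub>R (v x * \<psi> x) \<partial>lborel)"
    proof (rule integral_mono)
      fix x
      show "\<mu> * \<psi> x \<le> indicator Q x *\<^sub>R (v x * \<psi> x)"
        using lower[of x] \<psi>0[of x] \<psi>_nonneg[of x]
        by (cases "x \<in> Q") (auto simp: Q_def intro: mult_right_mono)
    qed (use int \<psi>_int in auto)
    also have "\<dots> = (LINT x:\<Omega>|lebesgue. v x * \<psi> x)"
      unfolding set_lebesgue_integral_def eq
      by (rule integral_completion[symmetric]) (use borel_measurable_integrable[OF int] in simp)
    finally show ?thesis .
  qed
  also note main
  also have "(LINT x:\<Omega>|lebesgue. V x \<bullet> grad \<psi> x) \<le> (\<Sum>j\<in>UNIV. B * (\<integral>x. \<bar>partial j \<psi> x\<bar> \<partial>lborel))"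
  proof -
    have int: "integrable lborel (\<lambda>x. \<bar>partial j \<psi> x\<bar>)" for j
      unfolding \<psi>_def partial_cube_bump[OF e a]
      by (intro integrable_abs integrable_cube_bump[OF e a])
    have int': "integrable lborel (\<lambda>x. \<Sum>j\<in>UNIV. B * \<bar>partial j \<psi> x\<bar>)"
      using int by auto
    have "(LINT x:\<Omega>|lebesgue. V x \<bullet> grad \<psi> x) \<le> (\<integral>x. (\<Sum>j\<in>UNIV. B * \<bar>partial j \<psi> x\<bar>) \<partial>lebesgue)"
      unfolding set_lebesgue_integral_def
    proof (rule integral_mono') \<comment> \<open>if the left-hand side is not integrable, its integral is 0 by convention\<close>
      show "integrable lebesgue (\<lambda>x. \<Sum>j\<in>UNIV. B * \<bar>partial j \<psi> x\<bar>)"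
        using int' by (simp add: integrable_completion borel_measurable_integrable)
      fix x
      show "0 \<le> (\<Sum>j\<in>UNIV. B * \<bar>partial j \<psi> x\<bar>)" using B by (simp add: sum_nonneg)
      then show "indicator \<Omega> x *\<^sub>R (V x \<bullet> grad \<psi> x) \<le> (\<Sum>j\<in>UNIV. B * \<bar>partial j \<psi> x\<bar>)"
      proof (cases "x \<in> \<Omega>")
        case True
        have "V x \<bullet> grad \<psi> x \<le> norm (V x) * norm (grad \<psi> x)" by (rule norm_cauchy_schwarz)
        \<comment> \<open>The Euclidean norm gives way to the sum of the
          \<open>\<bar>partial j \<psi> x\<bar>\<close>, whose integrals are known exactly; this
          brings the dimension into the constant.\<close>
        also have "\<dots> \<le> B * (\<Sum>j\<in>UNIV. \<bar>grad \<psi> x $ j\<bar>)"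
          using V[OF True] B by (intro mult_mono norm_le_l1_cart) auto
        finally show ?thesis using True by (simp add: grad_def sum_distrib_left)
      qed simp
    qed
    also have "\<dots> = (\<integral>x. (\<Sum>j\<in>UNIV. B * \<bar>partial j \<psi> x\<bar>) \<partial>lborel)"
      by (rule integral_completion) (use borel_measurable_integrable[OF int'] in simp)
    also have "\<dots> = (\<Sum>j\<in>UNIV. B * (\<integral>x. \<bar>partial j \<psi> x\<bar> \<partial>lborel))"
      using int by (subst Bochner_Integration.integral_sum) auto
    finally show ?thesis .
  qed
  \<comment> \<open>The factor \<open>a * J\<close> prepares for
    \<open>integral_partial_cube_bump\<close>; in the end \<open>J * I\<close> cancels.\<close>
  finally have "(a * J) * (\<mu> * I) \<le> (a * J) * (\<Sum>j\<in>UNIV. B * (\<integral>x. \<bar>partial j \<psi> x\<bar> \<partial>lborel))"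
    using a J by (intro mult_left_mono) auto
  also have "\<dots> = (\<Sum>j\<in>UNIV. B * (a * J * (\<integral>x. \<bar>partial j \<psi> x\<bar> \<partial>lborel)))"
    by (simp add: sum_distrib_left mult_ac)
  also have "\<dots> = real CARD('n) * (B * (D * I))"
    using integral_partial_cube_bump[OF e a, of _ c] by (simp add: \<psi>_def J_def D_def I_def)
  also have "\<dots> \<le> real CARD('n) * (B * (3 / 2 * J * I))"
    using integral_abs_bump_deriv_1_le B I
    by (intro mult_left_mono mult_right_mono) (auto simp: D_def J_def e_def)
  finally have "(a * \<mu>) * (J * I) \<le> (3 / 2 * real CARD('n) * B) * (J * I)"
    by (simp add: mult_ac)
  then show ?thesis using I J by (simp add: mult_le_cancel_right)
qed

section \<open>Pointwise bounds on the flux and on the gradient\<close>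

lemma weakly_coercive_norm_le:
  assumes "p > 1" "k > 0" "weakly_coercive p k \<Omega> A" "x \<in> \<Omega>" "t \<ge> 0" "norm \<xi> \<le> c"
  shows "norm (A x t \<xi>) \<le> k powr (1 - p) * c powr (p - 1)"
proof (cases "A x t \<xi> = 0")
  case False
  define a where "a = norm (A x t \<xi>)"
  have a: "a > 0" using False by (simp add: a_def)
  have c: "c \<ge> 0" using assms(6) norm_ge_zero order_trans by blast
  have "k * a powr (p / (p - 1)) \<le> A x t \<xi> \<bullet> \<xi>"
    using assms unfolding weakly_coercive_def a_def by blast
  also have "\<dots> \<le> a * norm \<xi>" unfolding a_def by (rule norm_cauchy_schwarz)
  also have "\<dots> \<le> a * c" using a assms(6) by simp
  finally have "k * a powr (p / (p - 1)) \<le> a * c" .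
  \<comment> \<open>Splitting the exponent lets one factor \<open>a\<close> cancel; raising to the
    power \<open>p - 1\<close> then isolates \<open>a\<close>.\<close>
  moreover have "p / (p - 1) = 1 + 1 / (p - 1)" using assms(1) by (simp add: field_simps)
  ultimately have "a * (k * a powr (1 / (p - 1))) \<le> a * c"
    using a by (simp add: powr_add mult_ac)
  then have "a powr (1 / (p - 1)) \<le> c / k" using a assms(2) by (simp add: field_simps)
  then have "(a powr (1 / (p - 1))) powr (p - 1) \<le> (c / k) powr (p - 1)"
    using assms(1) by (intro powr_mono2) auto
  also have "(a powr (1 / (p - 1))) powr (p - 1) = a" using a assms(1) by (simp add: powr_powr)
  also have "(c / k) powr (p - 1) = k powr (1 - p) * c powr (p - 1)"
    using c assms(2) powr_minus[of k "p - 1"] by (simp add: powr_divide field_simps)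
  finally show ?thesis by (simp add: a_def)
qed simp

lemma has_derivative_grad:
  fixes g :: "real^'n::finite \<Rightarrow> real"
  assumes "g differentiable at x"
  shows "(g has_derivative (\<lambda>h. grad g x \<bullet> h)) (at x)"
proof -
  define g' where "g' = frechet_derivative g (at x)"
  have g': "(g has_derivative g') (at x)"
    using assms unfolding g'_def by (simp add: frechet_derivative_works)
  have lin: "linear g'" using g' by (rule has_derivative_linear)
  have "g' h = grad g x \<bullet> h" for h
  proof -
    have "g' h = g' (\<Sum>i\<in>UNIV. (h $ i) *\<^sub>R axis i 1)"
      using basis_expansion[of h] by (simp add: scalar_mult_eq_scaleR)
    also have "\<dots> = grad g x \<bullet> h"
      unfolding linear_sum[OF lin] linear_scale[OF lin]
      by (simp add: grad_def partial_def g'_def inner_vec_def mult.commute)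
    finally show ?thesis .
  qed
  then have "g' = (\<lambda>h. grad g x \<bullet> h)" by auto
  then show ?thesis using g' by simp
qed

text \<open>The gradient is continuous, so the set where the essential bound fails is open; being
  null, it is empty.\<close>

lemma norm_grad_le_esssup:
  fixes u :: "real^'n::finite \<Rightarrow> real"
  assumes "open \<Omega>" "Ck_on 1 \<Omega> u"
    and c: "ereal c = esssup (lebesgue_on \<Omega>) (\<lambda>x. ereal (norm (grad u x)))"
    and "x \<in> \<Omega>"
  shows "norm (grad u x) \<le> c"
proof (rule ccontr)
  assume "\<not> norm (grad u x) \<le> c"
  define S where "S = \<Omega> \<inter> (\<lambda>y. norm (grad u y)) -` {c<..}"
  have "continuous_on \<Omega> (\<lambda>y. norm (grad u y))"
    using assms(2) unfolding grad_def by (auto intro!: continuous_intros)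
  then have S: "open S"
    unfolding S_def by (intro continuous_open_preimage assms) auto
  have "AE y in lebesgue_on \<Omega>. ereal (norm (grad u y)) \<le> ereal c"
    unfolding c by (rule esssup_AE)
  then have "AE y in lebesgue. y \<notin> S"
    using assms(1) by (subst (asm) AE_restrict_space_iff) (auto simp: S_def elim!: eventually_mono)
  then have "S \<in> null_sets lebesgue"
    using S by (subst AE_iff_null_sets) auto
  then have "S = {}"
    using open_not_negligible[OF S] by (auto simp: negligible_iff_null_sets)
  then show False using \<open>\<not> _\<close> \<open>x \<in> \<Omega>\<close> by (auto simp: S_def)
qed

lemma lipschitz_on_grad_bound:
  fixes u :: "real^'n::finite \<Rightarrow> real"
  assumes "convex \<Omega>" "\<And>x. x \<in> \<Omega> \<Longrightarrow> u differentiable at x"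
    and "\<And>x. x \<in> \<Omega> \<Longrightarrow> norm (grad u x) \<le> c" and "c \<ge> 0"
  shows "c-lipschitz_on \<Omega> u"
proof (rule lipschitz_onI)
  fix x y assume xy: "x \<in> \<Omega>" "y \<in> \<Omega>"
  have "norm (u x - u y) \<le> c * norm (x - y)"
  proof (rule differentiable_bound[OF assms(1) _ _ xy])
    fix z assume z: "z \<in> \<Omega>"
    show "(u has_derivative (\<lambda>h. grad u z \<bullet> h)) (at z within \<Omega>)"
      by (rule has_derivative_at_withinI[OF has_derivative_grad[OF assms(2)[OF z]]])
    show "onorm (\<lambda>h. grad u z \<bullet> h) \<le> c"
    proof (rule onorm_bound)
      fix h
      show "norm (grad u z \<bullet> h) \<le> c * norm h"
        using Cauchy_Schwarz_ineq2[of "grad u z" h] mult_right_mono[OF assms(3)[OF z], of "norm h"]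
        by simp
    qed (rule assms)
  qed
  then show "dist (u x) (u y) \<le> c * dist x y" by (simp add: dist_norm)
qed (rule assms)

text \<open>Squared, this goes by induction: from \<open>n \<ge> 2\<close> to \<open>n + 1\<close>
  the cube grows at most by the factor 4, while \<open>2 ^ n - 1\<close> at least doubles. It turns
  the dimensional factor of the cube estimate into the constant \<open>2 ^ n - 1\<close>.\<close>

lemma card_sqrt_le_power_2:
  assumes "n \<ge> 1"
  shows "real n * sqrt (real n) \<le> 2 ^ n - 1"
proof -
  have "real n ^ 3 \<le> (2 ^ n - 1)\<^sup>2"
    using assms
  proof (induction n rule: nat_induct_at_least)
    case (Suc n)
    show ?case
    \<comment> \<open>From 1 to 2 the cube grows by the factor 8, so this case is computed directly:
      \<open>8 \<le> 9\<close>.\<close>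
    proof (cases "n = 1")
      case False
      then have n: "real n \<ge> 2" using Suc.hyps by linarith
      have "real (Suc n) ^ 3 = real n ^ 3 + 3 * real n ^ 2 + 3 * real n + 1"
        by (simp add: power3_eq_cube power2_eq_square algebra_simps)
      also have "\<dots> \<le> 4 * real n ^ 3"
      proof -
        have "real n ^ 3 \<ge> 2 * real n ^ 2" "real n ^ 2 \<ge> 2 * real n"
          using n by (auto simp: power2_eq_square power3_eq_cube intro!: mult_right_mono)
        then show ?thesis using n by linarith
      qed
      also have "\<dots> \<le> 4 * (2 ^ n - 1)\<^sup>2"
        by (rule mult_left_mono[OF Suc.IH]) simp
      also have "\<dots> = (2 * (2 ^ n - 1))\<^sup>2"
        by (simp add: power2_eq_square algebra_simps)
      also have "\<dots> \<le> (2 ^ Suc n - 1)\<^sup>2"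
        using one_le_power[of "2::real" n] by (intro power_mono) auto
      finally show ?thesis .
    qed (simp add: power2_eq_square power3_eq_cube)
  qed simp
  moreover have "(real n * sqrt (real n))\<^sup>2 = real n ^ 3"
    by (simp add: power_mult_distrib power2_eq_square power3_eq_cube)
  ultimately show ?thesis
    by (metis diff_ge_0_iff_ge one_le_numeral one_le_power power2_le_imp_le)
qed

section \<open>The half-space\<close>

lemma open_half_space: "open (half_space m)"
  unfolding half_space_def by (intro open_Collect_less continuous_intros)

lemma convex_half_space: "convex (half_space m)"
proof -
  have "half_space m = {x. axis m 1 \<bullet> x > 0}"
    by (simp add: half_space_def inner_axis')
  then show ?thesis by (simp add: convex_halfspace_gt)
qed

lemma closure_half_space: "closure (half_space m) = {x. x $ m \<ge> 0}"
proof
  have "closed {x::real^'a. x $ m \<ge> 0}"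
    by (intro closed_Collect_le continuous_intros)
  then show "closure (half_space m) \<subseteq> {x. x $ m \<ge> 0}"
    by (intro closure_minimal) (auto simp: half_space_def)
  show "{x. x $ m \<ge> 0} \<subseteq> closure (half_space m)"
  proof
    fix x :: "real^'a" assume x: "x \<in> {x. x $ m \<ge> 0}"
    have "(\<lambda>n. x + inverse (real (Suc n)) *\<^sub>R axis m 1) \<longlonglongrightarrow> x + 0 *\<^sub>R axis m 1"
      by (intro tendsto_intros LIMSEQ_inverse_real_of_nat)
    moreover have "x + inverse (real (Suc n)) *\<^sub>R axis m 1 \<in> half_space m" for n
      using x by (simp add: half_space_def axis_def add_nonneg_pos)
    ultimately show "x \<in> closure (half_space m)"
      unfolding closure_sequential by force
  qed
qed

lemma frontier_half_space: "frontier (half_space m) = {x. x $ m = 0}"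
  unfolding frontier_def closure_half_space interior_open[OF open_half_space]
  by (auto simp: half_space_def)

lemma norm_const_vec: "a \<ge> 0 \<Longrightarrow> norm ((\<chi> i. a) :: real^'n::finite) = sqrt (real CARD('n)) * a"
  by (simp add: norm_vec_def L2_set_def real_sqrt_mult)

section \<open>The generalized inverse and the equation for the radius\<close>

lemma gen_inverse_upper: "t \<ge> 0 \<Longrightarrow> f t \<le> s \<Longrightarrow> ereal t \<le> gen_inverse f s"
  unfolding gen_inverse_def by (rule SUP_upper) simp

text \<open>By strict monotonicity \<open>f t \<le> f r\<close> forces \<open>t \<le> r\<close>, so
  no \<open>t\<close> beyond \<open>r\<close> enters the supremum.\<close>

lemma gen_inverse_strict_mono_le:
  assumes "strict_mono_on {0..} f" "r \<ge> 0"
  shows "gen_inverse f (f r) \<le> ereal r"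
  unfolding gen_inverse_def
  using assms by (intro SUP_least) (auto simp: strict_mono_on_leD strict_mono_on_less_eq)

text \<open>As a function of \<open>R\<close>, \<open>R * f (c * R)\<close> is continuous and
  strictly increasing, vanishes at 0 and eventually reaches \<open>s\<close>.\<close>

lemma ex1_mult_comp_eq:
  assumes f: "continuous_on {0..} f" "strict_mono_on {0..} f" "f 0 = (0::real)"
      "filterlim f at_top at_top"
    and c: "c > 0" and s: "s > 0"
  shows "\<exists>!R::real. R > 0 \<and> R * f (c * R) = s"
proof -
  have pos: "f t > 0" if "t > 0" for t
    using strict_mono_onD[OF f(2), of 0 t] that f(3) by simp
  have mono: "R * f (c * R) < S * f (c * S)" if "0 < R" "R < S" for R S
    using strict_mono_onD[OF f(2), of "c * R" "c * S"] that c pos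
    by (intro mult_strict_mono) (auto simp: less_imp_le)
  obtain T where T: "\<And>t. t \<ge> T \<Longrightarrow> f t \<ge> s"
    using f(4) unfolding filterlim_at_top eventually_at_top_linorder by meson
  define S where "S = max 1 (T / c)"
  have S: "S \<ge> 1" "c * S \<ge> T" using c by (auto simp: S_def field_simps max_def)
  have "\<exists>R. 0 \<le> R \<and> R \<le> S \<and> R * f (c * R) = s"
  proof (rule IVT')
    have "1 * s \<le> S * f (c * S)" using S T s by (intro mult_mono) auto
    then show "s \<le> S * f (c * S)" by simp
    show "continuous_on {0..S} (\<lambda>R. R * f (c * R))"
      using c by (intro continuous_intros continuous_on_compose2[OF f(1)]) auto
  qed (use s S in auto)
  then obtain R where R: "0 \<le> R" "R * f (c * R) = s" by blast
  then have "R > 0" using s by (cases "R = 0") auto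
  show ?thesis
  proof (rule ex1I[of _ R])
    fix R' assume "R' > 0 \<and> R' * f (c * R') = s"
    then show "R' = R" using mono[of R R'] mono[of R' R] R \<open>R > 0\<close>
      by (cases R R' rule: linorder_cases) auto
  qed (use R \<open>R > 0\<close> in auto)
qed

section \<open>The bound for a fixed radius\<close>

lemma half_space_sup_bound:
  fixes m :: "'n::finite" and A :: "real^'n \<Rightarrow> real \<Rightarrow> real^'n \<Rightarrow> real^'n"
  assumes "p > 1" "k > 0"
    and coer: "weakly_coercive p k (half_space m) A"
    and f: "continuous_on {0..} f" "mono_on {0..} f"
    and u: "Ck_on 1 (half_space m) u" "continuous_on (closure (half_space m)) u"
      "\<forall>x\<in>closure (half_space m). u x \<ge> 0"
    and weak: "\<forall>\<psi>\<in>test_functions (half_space m). (\<forall>x. \<psi> x \<ge> 0) \<longrightarrow>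
           (LINT x:half_space m|lebesgue. A x (u x) (grad u x) \<bullet> grad \<psi> x)
             \<ge> (LINT x:half_space m|lebesgue. f (u x) * \<psi> x)"
    and c1: "\<And>x. x \<in> half_space m \<Longrightarrow> norm (grad u x) \<le> c1" "c1 \<ge> 0"
    and c2: "\<And>x. x \<in> frontier (half_space m) \<Longrightarrow> u x \<le> c2"
    and R: "R > 0"
  shows "(SUP x\<in>half_space m. ereal (u x))
             \<le> max (ereal (c2 + c1 * R))
                 (gen_inverse f ((2 ^ CARD('n) - 1) * k powr (1 - p) * c1 powr (p - 1) / R) + ereal (2 * c1 * R))"
proof (rule SUP_least)
  fix x assume x: "x \<in> half_space m"
  define B where "B = k powr (1 - p) * c1 powr (p - 1)"
  define s where "s = (2 ^ CARD('n) - 1) * k powr (1 - p) * c1 powr (p - 1) / R"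
  have sub: "half_space m \<subseteq> closure (half_space m)" by (rule closure_subset)
  have u0: "u y \<ge> 0" if "y \<in> half_space m" for y using u(3) sub that by blast
  have "c1-lipschitz_on (half_space m) u"
    by (rule lipschitz_on_grad_bound[OF convex_half_space _ c1]) (use u(1) in auto)
  \<comment> \<open>On the closure, points of the half-space can be compared with boundary
    points.\<close>
  then have lip: "c1-lipschitz_on (closure (half_space m)) u"
    by (rule lipschitz_on_closure) (rule u(2))
  have growth: "u y \<le> u z + c1 * r"
    if "y \<in> closure (half_space m)" "z \<in> closure (half_space m)" "norm (y - z) \<le> r" for y z r
    using lipschitz_onD[OF lip that(1,2)] mult_left_mono[OF that(3) c1(2)]
    by (simp add: dist_norm)
  show "ereal (u x) \<le> max (ereal (c2 + c1 * R)) (gen_inverse f s + ereal (2 * c1 * R))"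
  proof (cases "x $ m \<le> R")
    case True
    define z where "z = x - (x $ m) *\<^sub>R axis m 1"
    have z: "z \<in> frontier (half_space m)" by (simp add: z_def frontier_half_space axis_def)
    have "u x \<le> u z + c1 * R"
      using x True z by (intro growth) (auto simp: frontier_def z_def half_space_def closure_half_space)
    then have "ereal (u x) \<le> ereal (c2 + c1 * R)" using c2[OF z] by simp
    then show ?thesis by (simp add: le_max_iff_disj)
  next
    case False
    define N where "N = real CARD('n)"
    \<comment> \<open>The half diagonal \<open>sqrt N * a = 3 * R / 2\<close> plus the shift
      \<open>R / 2\<close> of the centre gives the distance \<open>2 * R\<close>. The shift suits
      the worst case \<open>N = 1\<close>, where \<open>a = 3 * R / 2\<close> and the cube reaches
      down to height \<open>x $ m - R\<close>, still positive.\<close>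
    define a where "a = 3 * R / (2 * sqrt N)"
    define c where "c = x + (R / 2) *\<^sub>R axis m 1"
    define Q where "Q = cbox (c - (\<chi> i. a)) (c + (\<chi> i. a))"
    have N: "N \<ge> 1" by (simp add: N_def Suc_leI)
    have a: "a > 0" "a \<le> 3 * R / 2" "sqrt N * a = 3 * R / 2"
      using N R by (auto simp: a_def field_simps)
    have Q: "Q \<subseteq> half_space m"
    proof
      fix y assume "y \<in> Q"
      then have "c $ m - a \<le> y $ m" by (simp add: Q_def mem_box_cart)
      moreover have "c $ m = x $ m + R / 2" by (simp add: c_def axis_def)
      ultimately show "y \<in> half_space m" using False a by (simp add: half_space_def)
    qed
    have near: "norm (x - y) \<le> 2 * R" if "y \<in> Q" for y
    proof -
      have "norm (c - y) \<le> norm ((\<chi> i. a) :: real^'n)"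
        by (rule norm_le_componentwise_cart)
           (use that a in \<open>auto simp: Q_def mem_box_cart abs_le_iff algebra_simps\<close>)
      also have "\<dots> = 3 * R / 2" using a by (simp add: N_def norm_const_vec)
      finally have "norm (c - y) \<le> 3 * R / 2" .
      moreover have "norm (x - c) = R / 2" using R by (simp add: c_def)
      ultimately show ?thesis using norm_triangle_ineq[of "x - c" "c - y"] by simp
    qed
    have "c \<in> Q" using a by (simp add: Q_def mem_box_cart)
    then have "Q \<noteq> {}" by blast
    moreover have "compact Q" by (simp add: Q_def)
    moreover have "continuous_on Q u" using continuous_on_subset[OF u(2)] Q sub by blast
    \<comment> \<open>The minimum point serves twice: by monotonicity \<open>f (u y)\<close> is a
      lower bound for f(u) on the cube, and \<open>u x\<close> exceeds \<open>u y\<close> by at most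
      \<open>2 * c1 * R\<close>.\<close>
    ultimately obtain y where y: "y \<in> Q" "\<And>z. z \<in> Q \<Longrightarrow> u y \<le> u z"
      using continuous_attains_inf[of Q u] by blast
    have "a * f (u y) \<le> 3 / 2 * real CARD('n) * B"
    proof (rule weak_inequality_cube_bound[where \<Omega> = "half_space m" and V = "\<lambda>x. A x (u x) (grad u x)"
          and v = "\<lambda>x. f (u x)" and c = c])
      show "continuous_on (half_space m) (\<lambda>x. f (u x))"
        using u0 by (intro continuous_on_compose2[OF f(1) continuous_on_subset[OF u(2) sub]]) auto
      show "norm (A z (u z) (grad u z)) \<le> B" if "z \<in> half_space m" for z
        unfolding B_def using weakly_coercive_norm_le[OF assms(1,2) coer that] u0 c1 that by blast
      show "f (u y) \<le> f (u z)" if "z \<in> cbox (c - (\<chi> i. a)) (c + (\<chi> i. a))" for z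
        using that y Q u0 mono_onD[OF f(2), of "u y" "u z"] by (auto simp: Q_def)
    qed (use a Q weak in \<open>auto simp: Q_def B_def\<close>)
    \<comment> \<open>The factor \<open>sqrt N\<close> turns \<open>a\<close> into
      \<open>3 * R / 2\<close> and \<open>N\<close> into \<open>N * sqrt N\<close>; the factors
      \<open>3 / 2\<close> then cancel.\<close>
    then have "(sqrt N * a) * f (u y) \<le> 3 / 2 * (N * sqrt N) * B"
      using mult_left_mono[of "a * f (u y)" _ "sqrt N"] N by (simp add: N_def mult_ac)
    also have "\<dots> \<le> 3 / 2 * (2 ^ CARD('n) - 1) * B"
      using card_sqrt_le_power_2[of "CARD('n)"] unfolding N_def
      by (intro mult_right_mono mult_left_mono) (auto simp: B_def Suc_leI)
    finally have "R * f (u y) \<le> (2 ^ CARD('n) - 1) * B" unfolding a(3) by (simp add: algebra_simps)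
    then have "f (u y) \<le> s" using R by (simp add: s_def B_def pos_le_divide_eq mult_ac)
    \<comment> \<open>So \<open>u y\<close> lies in the set whose supremum is
      \<open>gen_inverse f s\<close>, which in this case is not \<open>-\<infinity>\<close>.\<close>
    then have "ereal (u y) \<le> gen_inverse f s"
      using u0 y Q by (intro gen_inverse_upper) auto
    moreover have "u x \<le> u y + c1 * (2 * R)"
      using x y Q sub by (intro growth near) auto
    then have "ereal (u x) \<le> ereal (u y) + ereal (2 * c1 * R)" by (simp add: mult_ac)
    ultimately have "ereal (u x) \<le> gen_inverse f s + ereal (2 * c1 * R)"
      by (meson add_right_mono order_trans)
    then show ?thesis by (simp add: le_max_iff_disj)
  qed
qed

theorem theorem1:
  fixes m :: "'n::finite"
    and p k c0 c1 c2 :: real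
    and A :: "real^'n \<Rightarrow> real \<Rightarrow> real^'n \<Rightarrow> real^'n"
    and f :: "real \<Rightarrow> real"
    and u :: "real^'n \<Rightarrow> real"
  assumes "p > 1" and "k > 0"
    and "caratheodory (half_space m) A"
    and "weakly_coercive p k (half_space m) A"
    and "continuous_on {0..} f" and "mono_on {0..} f" and "\<forall>t\<ge>0. f t \<ge> 0"
    and "filterlim f at_top at_top"
    and "Ck_on 1 (half_space m) u" and "continuous_on (closure (half_space m)) u"
    and "\<forall>x\<in>closure (half_space m). u x \<ge> 0"
    and "\<forall>\<psi>\<in>test_functions (half_space m). (\<forall>x. \<psi> x \<ge> 0) \<longrightarrow>
           (LINT x:half_space m|lebesgue. A x (u x) (grad u x) \<bullet> grad \<psi> x)
             \<ge> (LINT x:half_space m|lebesgue. f (u x) * \<psi> x)"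
    and "ereal c1 = esssup (lebesgue_on (half_space m)) (\<lambda>x. ereal (norm (grad u x)))"
    and "bdd_above (u ` frontier (half_space m))"
    and "c2 = (SUP x\<in>frontier (half_space m). u x)"
    and "c0 = 2 ^ CARD('n) - 1"
  shows "(\<forall>R>0. (SUP x\<in>half_space m. ereal (u x))
             \<le> max (ereal (c2 + c1 * R))
                 (gen_inverse f (c0 * k powr (1 - p) * c1 powr (p - 1) / R) + ereal (2 * c1 * R)))
       \<and> (strict_mono_on {0..} f \<and> f 0 = 0 \<and> c1 > 0 \<longrightarrow>
            (\<exists>!R. R > 0 \<and> R * f (c1 * R) = c0 * k powr (1 - p) * c1 powr (p - 1)) \<and>
            (\<forall>R. R > 0 \<and> R * f (c1 * R) = c0 * k powr (1 - p) * c1 powr (p - 1) \<longrightarrow>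
               (SUP x\<in>half_space m. ereal (u x)) \<le> ereal (max (c2 + c1 * R) (3 * c1 * R))))"
proof -
  have grad: "norm (grad u x) \<le> c1" if "x \<in> half_space m" for x
    using norm_grad_le_esssup[OF open_half_space assms(9,13) that] .
  have "axis m 1 \<in> half_space m" by (simp add: half_space_def axis_def)
  then have c1: "c1 \<ge> 0" using grad norm_ge_zero order_trans by blast
  have c2: "u x \<le> c2" if "x \<in> frontier (half_space m)" for x
    unfolding assms(15) by (rule cSUP_upper[OF that assms(14)])
  have bound: "(SUP x\<in>half_space m. ereal (u x)) \<le> max (ereal (c2 + c1 * R))
        (gen_inverse f (c0 * k powr (1 - p) * c1 powr (p - 1) / R) + ereal (2 * c1 * R))" if "R > 0" for R
    unfolding assms(16)
    by (rule half_space_sup_bound[OF assms(1,2,4,5,6,9-12) grad c1 c2 that])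
  moreover have "\<exists>!R. R > 0 \<and> R * f (c1 * R) = c0 * k powr (1 - p) * c1 powr (p - 1)"
    if "strict_mono_on {0..} f" "f 0 = 0" "c1 > 0"
  proof (rule ex1_mult_comp_eq[OF assms(5) that(1,2) assms(8) that(3)])
    have "(2::real) ^ CARD('n) > 1" by (rule one_less_power) auto
    then show "0 < c0 * k powr (1 - p) * c1 powr (p - 1)" using assms(2,16) that by simp
  qed
  moreover have "(SUP x\<in>half_space m. ereal (u x)) \<le> ereal (max (c2 + c1 * R) (3 * c1 * R))"
    if "strict_mono_on {0..} f" "R > 0" "R * f (c1 * R) = c0 * k powr (1 - p) * c1 powr (p - 1)" for R
  proof -
    \<comment> \<open>The equation for \<open>R\<close> makes the argument of
      \<open>gen_inverse\<close> the value of \<open>f\<close> at \<open>c1 * R\<close>, so the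
      inverse is at most \<open>c1 * R\<close> and the second term at most
      \<open>3 * c1 * R\<close>.\<close>
    have "c0 * k powr (1 - p) * c1 powr (p - 1) / R = f (c1 * R)"
      using that by (simp add: field_simps)
    then have "gen_inverse f (c0 * k powr (1 - p) * c1 powr (p - 1) / R) + ereal (2 * c1 * R)
        \<le> ereal (c1 * R) + ereal (2 * c1 * R)"
      using gen_inverse_strict_mono_le[OF that(1), of "c1 * R"] c1 that(2)
      by (intro add_right_mono) simp
    also have "\<dots> = ereal (3 * c1 * R)" by simp
    finally have "max (ereal (c2 + c1 * R))
        (gen_inverse f (c0 * k powr (1 - p) * c1 powr (p - 1) / R) + ereal (2 * c1 * R))
        \<le> max (ereal (c2 + c1 * R)) (ereal (3 * c1 * R))"
      by (intro max.mono order_refl)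
    also have "\<dots> = ereal (max (c2 + c1 * R) (3 * c1 * R))" by (simp add: max_def)
    finally show ?thesis using bound[OF that(2)] by (rule order_trans[rotated])
  qed
  ultimately show ?thesis by blast
qed

end
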